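(* For all integers $n,T>0$, there exists a principal-agent problem $(\mathbf c,\mathbf F,\mathbf r)$ with $T$ types, $n+1$ actions, and four outcomes that satisfies $$\mathrm{OptLinear}(\mathbf c,\mathbf F,\mathbf r)\ \le\ O\left(\frac{1}{n\log T}\right)\mathrm{OptSingle}(\mathbf c,\mathbf F,\mathbf r).$$
   Context: A (typed) principal-agent problem $(\mathbf c,\mathbf F,\mathbf r)$ with $N$ actions, $m$ outcomes and $T$ types consists of: costs $\mathbf c\in\mathbb R_{\ge 0}^N$ (the same for all types), where some action has cost $0$; rewards $\mathbf r\in\mathbb R_{\ge0}^m$, where some outcome has reward $0$ (the ordering of actions and outcomes is immaterial); and, for each type $t\in[T]$ and action $i\in[N]$, a probability distribution $(F^{(t)}_{i,j})_{j\in[m]}$ over outcomes. The agent's type is uniform on $[T]$; $\mathbb E_t$ denotes the expectation over it. A contract is a vector $\mathbf x\in\mathbb R_{\ge0}^m$. Under $\mathbf x$, an agent of type $t$ plays an action $i_*^{(t)}(\mathbf x)\in\arg\max_i\big(\sum_j F^{(t)}_{i,j}x_j-c_i\big)$, ties being broken so as to maximize the principal's profit $\mathrm{Profit}^{(t)}(\mathbf x)=\sum_j F^{(t)}_{i_*^{(t)}(\mathbf x),j}(r_j-x_j)$. $\mathrm{OptSingle}=\max_{\mathbf x}\mathbb E_t[\mathrm{Profit}^{(t)}(\mathbf x)]$ (best single contract); $\mathrm{OptLinear}=\max_{\alpha\in[0,1]}\mathbb E_t[\mathrm{Profit}^{(t)}(\alpha\mathbf r)]$ (best linear contract $\mathbf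 x=\alpha\mathbf r$). The constant hidden in $O$ is absolute. *)

theory Defs
  imports Complex_Main
begin

text \<open>
  Actions, outcomes and types are the indices \<open>i < N\<close>, \<open>j < m\<close> and \<open>t < T\<close>; the values of
  \<open>c\<close>, \<open>F\<close>, \<open>r\<close> and of a contract outside these ranges are never used. \<open>F t i j\<close> is the
  probability that action \<open>i\<close> of an agent of type \<open>t\<close> leads to outcome \<open>j\<close>.
\<close>

definition prob_vector :: "nat \<Rightarrow> (nat \<Rightarrow> real) \<Rightarrow> bool" where
  "prob_vector m p \<longleftrightarrow> (\<forall>j<m. 0 \<le> p j) \<and> (\<Sum>j<m. p j) = 1"

definition principal_agent ::
  "nat \<Rightarrow> nat \<Rightarrow> nat \<Rightarrow> (nat \<Rightarrow> real) \<Rightarrow> (nat \<Rightarrow> nat \<Rightarrow> nat \<Rightarrow> real) \<Rightarrow> (nat \<Rightarrow> real) \<Rightarrow> bool" where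
  "principal_agent N m T c F r \<longleftrightarrow>
     0 < T \<and>
     (\<forall>i<N. 0 \<le> c i) \<and> (\<exists>i<N. c i = 0) \<and>
     (\<forall>j<m. 0 \<le> r j) \<and> (\<exists>j<m. r j = 0) \<and>
     (\<forall>t<T. \<forall>i<N. prob_vector m (F t i))"

definition contracts :: "nat \<Rightarrow> (nat \<Rightarrow> real) set" where
  "contracts m = {x. \<forall>j<m. 0 \<le> x j}"

definition agent_utility ::
  "nat \<Rightarrow> (nat \<Rightarrow> real) \<Rightarrow> (nat \<Rightarrow> nat \<Rightarrow> nat \<Rightarrow> real) \<Rightarrow> nat \<Rightarrow> (nat \<Rightarrow> real) \<Rightarrow> nat \<Rightarrow> real" where
  "agent_utility m c F t x i = (\<Sum>j<m. F t i j * x j) - c i"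

definition principal_payoff ::
  "nat \<Rightarrow> (nat \<Rightarrow> nat \<Rightarrow> nat \<Rightarrow> real) \<Rightarrow> (nat \<Rightarrow> real) \<Rightarrow> nat \<Rightarrow> (nat \<Rightarrow> real) \<Rightarrow> nat \<Rightarrow> real" where
  "principal_payoff m F r t x i = (\<Sum>j<m. F t i j * (r j - x j))"

definition best_responses ::
  "nat \<Rightarrow> nat \<Rightarrow> (nat \<Rightarrow> real) \<Rightarrow> (nat \<Rightarrow> nat \<Rightarrow> nat \<Rightarrow> real) \<Rightarrow> nat \<Rightarrow> (nat \<Rightarrow> real) \<Rightarrow> nat set" where
  "best_responses N m c F t x =
     {i. is_arg_max (agent_utility m c F t x) (\<lambda>i. i < N) i}"

definition played_action ::
  "nat \<Rightarrow> nat \<Rightarrow> (nat \<Rightarrow> real) \<Rightarrow> (nat \<Rightarrow> nat \<Rightarrow> nat \<Rightarrow> real) \<Rightarrow> (nat \<Rightarrow> real) \<Rightarrow> nat \<Rightarrow> (nat \<Rightarrow> real) \<Rightarrow> nat" where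
  "played_action N m c F r t x =
     arg_max_on (principal_payoff m F r t x) (best_responses N m c F t x)"

definition profit ::
  "nat \<Rightarrow> nat \<Rightarrow> (nat \<Rightarrow> real) \<Rightarrow> (nat \<Rightarrow> nat \<Rightarrow> nat \<Rightarrow> real) \<Rightarrow> (nat \<Rightarrow> real) \<Rightarrow> nat \<Rightarrow> (nat \<Rightarrow> real) \<Rightarrow> real" where
  "profit N m c F r t x = principal_payoff m F r t x (played_action N m c F r t x)"

definition expected_profit ::
  "nat \<Rightarrow> nat \<Rightarrow> nat \<Rightarrow> (nat \<Rightarrow> real) \<Rightarrow> (nat \<Rightarrow> nat \<Rightarrow> nat \<Rightarrow> real) \<Rightarrow> (nat \<Rightarrow> real) \<Rightarrow> (nat \<Rightarrow> real) \<Rightarrow> real" where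
  "expected_profit N m T c F r x = (\<Sum>t<T. profit N m c F r t x) / real T"

text \<open>
  Both suprema are over nonempty sets bounded above (see \<open>bdd_above_expected_profit\<close>) and are
  attained, so they are maxima: profit is upper semicontinuous because ties favour the principal,
  which settles the compact range of \<open>\<alpha>\<close>; for general contracts, those under which a given
  profile of actions is a best response form a polyhedron, on which the expected payoff of that
  profile is affine and bounded above.
\<close>

definition opt_single ::
  "nat \<Rightarrow> nat \<Rightarrow> nat \<Rightarrow> (nat \<Rightarrow> real) \<Rightarrow> (nat \<Rightarrow> nat \<Rightarrow> nat \<Rightarrow> real) \<Rightarrow> (nat \<Rightarrow> real) \<Rightarrow> real" where
  "opt_single N m T c F r = (SUP x\<in>contracts m. expected_profit N m T c F r x)"

definition opt_linear ::
  "nat \<Rightarrow> nat \<Rightarrow> nat \<Rightarrow> (nat \<Rightarrow> real) \<Rightarrow> (nat \<Rightarrow> nat \<Rightarrow> nat \<Rightarrow> real) \<Rightarrow> (nat \<Rightarrow> real) \<Rightarrow> real" where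
  "opt_linear N m T c F r =
     (SUP \<alpha>\<in>{0..1::real}. expected_profit N m T c F r (\<lambda>j. \<alpha> * r j))"

lemma finite_ex_is_arg_max:
  fixes f :: "'a \<Rightarrow> real"
  assumes "finite S" "S \<noteq> {}"
  shows "\<exists>x. is_arg_max f (\<lambda>x. x \<in> S) x"
proof -
  have "Max (f ` S) \<in> f ` S" using assms by (intro Max_in) auto
  then obtain x where "x \<in> S" "f x = Max (f ` S)" by auto
  then have "is_arg_max f (\<lambda>x. x \<in> S) x"
    using assms by (auto simp: is_arg_max_linorder)
  then show ?thesis by blast
qed

lemma best_responses_finite_nonempty:
  assumes "0 < N"
  shows "finite (best_responses N m c F t x)" "best_responses N m c F t x \<noteq> {}"
proof -
  show "finite (best_responses N m c F t x)"
    by (rule finite_subset[of _ "{..<N}"]) (auto simp: best_responses_def is_arg_max_def)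
  have "{..<N} \<noteq> {}" using assms by auto
  from finite_ex_is_arg_max[OF finite_lessThan this, of "agent_utility m c F t x"]
  show "best_responses N m c F t x \<noteq> {}" by (auto simp: best_responses_def)
qed

lemma played_action_is_arg_max:
  assumes "0 < N"
  shows "is_arg_max (principal_payoff m F r t x) (\<lambda>i. i \<in> best_responses N m c F t x)
           (played_action N m c F r t x)"
  unfolding played_action_def arg_max_on_def arg_max_def
  by (rule someI_ex) (rule finite_ex_is_arg_max[OF best_responses_finite_nonempty[OF assms]])

lemma profit_eq_Max:
  assumes "0 < N"
  shows "profit N m c F r t x =
           Max (principal_payoff m F r t x ` best_responses N m c F t x)"
  using played_action_is_arg_max[OF assms, of m F r t x c]
    best_responses_finite_nonempty[OF assms, of m c F t x]
  unfolding profit_def is_arg_max_linorder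
  by (intro Max_eqI[symmetric]) auto

lemma profit_le_sum_rewards:
  assumes P: "principal_agent N m T c F r" and t: "t < T" and x: "x \<in> contracts m"
  shows "profit N m c F r t x \<le> (\<Sum>j<m. r j)"
proof -
  have N: "0 < N" using P by (auto simp: principal_agent_def)
  define i where "i = played_action N m c F r t x"
  have "i < N"
    using played_action_is_arg_max[OF N, of m F r t x c]
    by (auto simp: i_def is_arg_max_def best_responses_def)
  then have F: "prob_vector m (F t i)" using P t by (auto simp: principal_agent_def)
  have "F t i j * (r j - x j) \<le> r j" if j: "j < m" for j
  proof -
    have "F t i j \<le> (\<Sum>j<m. F t i j)"
      using F j by (intro member_le_sum) (auto simp: prob_vector_def)
    then have "F t i j \<le> 1" using F by (simp add: prob_vector_def)
    moreover have "0 \<le> F t i j" "0 \<le> r j" "0 \<le> x j"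
      using F P x j by (auto simp: prob_vector_def principal_agent_def contracts_def)
    moreover have "F t i j * (r j - x j) \<le> F t i j * r j"
      using calculation by (intro mult_left_mono) auto
    moreover have "F t i j * r j \<le> 1 * r j"
      using calculation by (intro mult_right_mono) auto
    ultimately show ?thesis by linarith
  qed
  then show ?thesis
    unfolding profit_def principal_payoff_def i_def[symmetric] by (intro sum_mono) auto
qed

lemma linear_contract: "principal_agent N m T c F r \<Longrightarrow> 0 \<le> \<alpha> \<Longrightarrow> (\<lambda>j. \<alpha> * r j) \<in> contracts m"
  by (auto simp: principal_agent_def contracts_def)

lemma bdd_above_expected_profit:
  assumes P: "principal_agent N m T c F r"
  shows "bdd_above (expected_profit N m T c F r ` contracts m)"
    and "bdd_above ((\<lambda>\<alpha>. expected_profit N m T c F r (\<lambda>j. \<alpha> * r j)) ` {0..1})"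
proof -
  have T: "0 < T" using P by (auto simp: principal_agent_def)
  have *: "expected_profit N m T c F r x \<le> (\<Sum>j<m. r j)" if "x \<in> contracts m" for x
  proof -
    have "(\<Sum>t<T. profit N m c F r t x) \<le> (\<Sum>t<T. \<Sum>j<m. r j)"
      using profit_le_sum_rewards[OF P _ that] by (intro sum_mono) auto
    then show ?thesis using T by (simp add: expected_profit_def field_simps)
  qed
  then show "bdd_above (expected_profit N m T c F r ` contracts m)"
    by (auto intro!: bdd_aboveI2)
  show "bdd_above ((\<lambda>\<alpha>. expected_profit N m T c F r (\<lambda>j. \<alpha> * r j)) ` {0..1})"
    using * linear_contract[OF P] by (intro bdd_aboveI2[where M = "\<Sum>j<m. r j"]) auto
qed

end

theory Submission
  imports Defs
begin

text \<open>
  An outcome with reward \<open>0\<close> whose probability is proportional to the cost of the action lets a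
  single contract reimburse every action exactly. All agents are then indifferent and choose in the
  principal's favour, so the principal obtains the full welfare of every type, and it suffices to
  separate linear contracts from the welfare.

  The costs have increments \<open>T ^ (k + 1)\<close>, and type \<open>t\<close> moves from action \<open>k\<close> to \<open>k + 1\<close> at the
  linear contract \<open>1 - \<delta>\<close> with \<open>\<delta> = 1 / (2 (t + 1) T ^ k)\<close>. This move adds at least
  \<open>T ^ (k + 1) \<delta> = T / (2 (t + 1))\<close> to the welfare, so the average welfare is at least \<open>n H\<^sub>T / 2\<close>. For a
  fixed \<open>k\<close> the breakpoints of the types are spaced as in an equal-revenue distribution, so the last
  level reached by a linear contract contributes \<open>O(1)\<close> to the profit, and the levels before it
  contribute a geometric sum.
\<close>

section \<open>Instances with an outcome that signals the cost\<close>

text \<open>With reward \<open>M\<close> on outcome 1 alone, \<open>R t i\<close> is the expected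
  reward of action \<open>i\<close>. Outcome 2 is the signal of its cost, and outcome 0 absorbs the
  remaining mass.\<close>

definition signal_prob :: "real \<Rightarrow> (nat \<Rightarrow> real) \<Rightarrow> (nat \<Rightarrow> nat \<Rightarrow> real) \<Rightarrow> nat \<Rightarrow> nat \<Rightarrow> nat \<Rightarrow> real" where
  "signal_prob M c R t i j =
     (if j = 0 then 1 - R t i / M - c i / M
      else if j = 1 then R t i / M else if j = 2 then c i / M else 0)"

definition signal_reward :: "real \<Rightarrow> nat \<Rightarrow> real" where
  "signal_reward M j = (if j = 1 then M else 0)"

lemma sum_lessThan_4: "(\<Sum>j<4. f j) = f 0 + f 1 + f 2 + f (3::nat)" for f :: "nat \<Rightarrow> real"
  by (simp add: eval_nat_numeral)

lemma principal_agent_signal: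
  assumes "0 < T" "0 < N" "0 < M" "c 0 = 0" "\<And>i. i < N \<Longrightarrow> 0 \<le> c i"
    and "\<And>t i. t < T \<Longrightarrow> i < N \<Longrightarrow> 0 \<le> R t i \<and> R t i + c i \<le> M"
  shows "principal_agent N 4 T c (signal_prob M c R) (signal_reward M)"
proof -
  have "prob_vector 4 (signal_prob M c R t i)" if "t < T" "i < N" for t i
  proof -
    have "(R t i + c i) / M \<le> 1"
      using assms that by (simp add: divide_le_eq)
    then show ?thesis
      using assms that
      by (auto simp: prob_vector_def signal_prob_def sum_lessThan_4 add_divide_distrib)
  qed
  moreover have "\<exists>i<N. c i = 0" using assms by blast
  moreover have "\<exists>j<4. signal_reward M j = 0"
    by (rule exI[of _ 0]) (simp add: signal_reward_def)
  ultimately show ?thesis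
    using assms by (auto simp: principal_agent_def signal_reward_def)
qed

lemma agent_utility_signal_linear:
  "0 < M \<Longrightarrow> agent_utility 4 c (signal_prob M c R) t (\<lambda>j. \<alpha> * signal_reward M j) i = \<alpha> * R t i - c i"
  by (simp add: agent_utility_def sum_lessThan_4 signal_prob_def signal_reward_def)

lemma principal_payoff_signal_linear:
  "0 < M \<Longrightarrow> principal_payoff 4 (signal_prob M c R) (signal_reward M) t
     (\<lambda>j. \<alpha> * signal_reward M j) i = (1 - \<alpha>) * R t i"
  by (simp add: principal_payoff_def sum_lessThan_4 signal_prob_def signal_reward_def field_simps)

lemma profit_signal_linear:
  assumes "0 < N" "0 < M"
  obtains i where "i < N" "\<And>k. k < N \<Longrightarrow> \<alpha> * R t k - c k \<le> \<alpha> * R t i - c i"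
    and "profit N 4 c (signal_prob M c R) (signal_reward M) t (\<lambda>j. \<alpha> * signal_reward M j)
           = (1 - \<alpha>) * R t i"
proof
  let ?i = "played_action N 4 c (signal_prob M c R) (signal_reward M) t (\<lambda>j. \<alpha> * signal_reward M j)"
  have "?i \<in> best_responses N 4 c (signal_prob M c R) t (\<lambda>j. \<alpha> * signal_reward M j)"
    using played_action_is_arg_max[OF assms(1)] by (auto simp: is_arg_max_linorder)
  then show "?i < N" and "\<And>k. k < N \<Longrightarrow> \<alpha> * R t k - c k \<le> \<alpha> * R t ?i - c ?i"
    using assms(2) by (auto simp: best_responses_def is_arg_max_linorder agent_utility_signal_linear)
  show "profit N 4 c (signal_prob M c R) (signal_reward M) t (\<lambda>j. \<alpha> * signal_reward M j)
          = (1 - \<alpha>) * R t ?i"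
    using assms(2) by (simp add: profit_def principal_payoff_signal_linear)
qed

lemma welfare_le_profit_signal:
  assumes "0 < M" "i < N"
  shows "R t i - c i \<le> profit N 4 c (signal_prob M c R) (signal_reward M) t (\<lambda>j. if j = 2 then M else 0)"
proof -
  let ?x = "\<lambda>j::nat. if j = 2 then M else 0"
  have "agent_utility 4 c (signal_prob M c R) t ?x k = 0" for k
    using assms by (simp add: agent_utility_def sum_lessThan_4 signal_prob_def)
  then have "i \<in> best_responses N 4 c (signal_prob M c R) t ?x"
    using assms by (simp add: best_responses_def is_arg_max_linorder)
  then have "principal_payoff 4 (signal_prob M c R) (signal_reward M) t ?x i
      \<le> profit N 4 c (signal_prob M c R) (signal_reward M) t ?x"
    using assms best_responses_finite_nonempty(1)[of N] by (subst profit_eq_Max) auto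
  moreover have "principal_payoff 4 (signal_prob M c R) (signal_reward M) t ?x i = R t i - c i"
    using assms by (simp add: principal_payoff_def sum_lessThan_4 signal_prob_def signal_reward_def)
  ultimately show ?thesis by simp
qed

section \<open>Costs, breakpoints and welfare of the instance\<close>

definition cost :: "nat \<Rightarrow> nat \<Rightarrow> real" where
  "cost T i = (\<Sum>k<i. real T ^ Suc k)"

text \<open>This is \<delta> from the overview. The factor 2 keeps it at most 1/2, so that dividing
  by \<open>1 - gap T t k\<close> at most doubles a term.\<close>

definition gap :: "nat \<Rightarrow> nat \<Rightarrow> nat \<Rightarrow> real" where
  "gap T t k = 1 / (2 * real (Suc t) * real T ^ k)"

text \<open>The increments make type \<open>t\<close> indifferent between actions \<open>k\<close>
  and \<open>k + 1\<close> exactly at \<alpha> = \<open>1 - gap T t k\<close>.\<close>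

definition mean_reward :: "nat \<Rightarrow> nat \<Rightarrow> nat \<Rightarrow> real" where
  "mean_reward T t i = (\<Sum>k<i. real T ^ Suc k / (1 - gap T t k))"

lemma gap_bounds:
  assumes "0 < T"
  shows "0 < gap T t k" "gap T t k \<le> 1 / 2"
proof -
  show "0 < gap T t k" using assms by (simp add: gap_def)
  have "1 * 1 \<le> real (Suc t) * real T ^ k"
    using assms by (intro mult_mono) auto
  then have "2 \<le> 2 * real (Suc t) * real T ^ k" by linarith
  then show "gap T t k \<le> 1 / 2" unfolding gap_def by (intro frac_le) auto
qed

lemma gap_antimono:
  assumes "0 < T" "k \<le> l"
  shows "gap T t l \<le> gap T t k"
proof -
  have "real T ^ k \<le> real T ^ l" using assms by (intro power_increasing) auto
  then show ?thesis
    unfolding gap_def using assms by (intro divide_left_mono mult_left_mono) auto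
qed

lemma increment_le:
  assumes "0 < T"
  shows "real T ^ Suc k / (1 - gap T t k) \<le> 2 * real T ^ Suc k"
proof -
  have "real T ^ Suc k / (1 - gap T t k) \<le> real T ^ Suc k / (1 / 2)"
    using gap_bounds[OF assms, of t k] assms by (intro divide_left_mono) auto
  then show ?thesis by simp
qed

lemma mean_reward_bounds:
  assumes "0 < T"
  shows "0 \<le> mean_reward T t i" "mean_reward T t i \<le> 2 * cost T i"
proof -
  show "0 \<le> mean_reward T t i"
    unfolding mean_reward_def
  proof (intro sum_nonneg divide_nonneg_nonneg)
    show "0 \<le> 1 - gap T t k" for k using gap_bounds(2)[OF assms, of t k] by simp
  qed simp
  show "mean_reward T t i \<le> 2 * cost T i"
    unfolding mean_reward_def cost_def sum_distrib_left by (intro sum_mono increment_le assms)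
qed

lemma welfare_ge:
  assumes "0 < T"
  shows "real n * real T / (2 * real (Suc t)) \<le> mean_reward T t n - cost T n"
proof -
  have "real T / (2 * real (Suc t)) \<le> real T ^ Suc k / (1 - gap T t k) - real T ^ Suc k" for k
  proof -
    have g: "0 < gap T t k" "gap T t k \<le> 1 / 2" using gap_bounds[OF assms] by auto
    have "real T / (2 * real (Suc t)) = real T ^ Suc k * gap T t k"
      using assms by (simp add: gap_def)
    \<comment> \<open>With g = \<open>gap T t k\<close>, the welfare increment carries the factor 1
      / (1 - g) - 1 = g / (1 - g), which is at least g.\<close>
    also have "\<dots> \<le> real T ^ Suc k * (gap T t k / (1 - gap T t k))"
      using g by (intro mult_left_mono) (auto simp: pos_le_divide_eq algebra_simps)
    also have "\<dots> = real T ^ Suc k / (1 - gap T t k) - real T ^ Suc k"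
      using g by (simp add: field_simps)
    finally show ?thesis .
  qed
  then have "(\<Sum>k<n. real T / (2 * real (Suc t))) \<le>
      (\<Sum>k<n. real T ^ Suc k / (1 - gap T t k) - real T ^ Suc k)"
    by (intro sum_mono)
  then show ?thesis by (simp add: mean_reward_def cost_def sum_subtractf)
qed

lemma ln_le_harmonic: "ln (real (Suc T)) \<le> (\<Sum>t<T. 1 / real (Suc t))"
proof (induction T)
  case (Suc T)
  have "ln (real (Suc (Suc T))) - ln (real (Suc T)) \<le> (real (Suc (Suc T)) - real (Suc T)) / real (Suc T)"
    by (rule ln_diff_le) auto
  with Suc show ?case by simp
qed simp

section \<open>Upper bound on the profit of linear contracts\<close>

text \<open>Comparing \<open>i\<close> with its predecessor alone gives the breakpoint just below
  \<open>i\<close>; the earlier ones follow because gaps shrink as the level grows.\<close>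

lemma best_response_breakpoints:
  assumes T: "0 < T" and i: "i < Suc n" and k: "k < i"
    and best: "\<And>l. l < Suc n \<Longrightarrow> \<alpha> * mean_reward T t l - cost T l \<le> \<alpha> * mean_reward T t i - cost T i"
  shows "1 - \<alpha> \<le> gap T t k"
proof -
  obtain l where l: "i = Suc l" using k by (cases i) auto
  have g: "gap T t l \<le> 1 / 2" by (rule gap_bounds[OF T])
  have "\<alpha> * mean_reward T t l - cost T l \<le> \<alpha> * mean_reward T t i - cost T i"
    using best l i by simp
  then have "1 * real T ^ Suc l \<le> \<alpha> / (1 - gap T t l) * real T ^ Suc l"
    by (simp add: l mean_reward_def cost_def algebra_simps)
  then have "1 \<le> \<alpha> / (1 - gap T t l)"
    by (rule mult_right_le_imp_le) (use T in simp)
  then have "1 - \<alpha> \<le> gap T t l" using g by (simp add: pos_le_divide_eq)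
  also have "\<dots> \<le> gap T t k" using T k l by (intro gap_antimono) auto
  finally show ?thesis .
qed

text \<open>The equal-revenue estimate: if s is the largest element of the set, there are at most s
  + 1 elements, and s itself satisfies (s + 1) \<open>y\<close> \<le> 1.\<close>

lemma card_multiples_le:
  assumes "0 < y"
  shows "real (card {t. t < T \<and> real (Suc t) * y \<le> 1}) * y \<le> 1"
proof (cases "{t. t < T \<and> real (Suc t) * y \<le> 1} = {}")
  case False
  let ?A = "{t. t < T \<and> real (Suc t) * y \<le> 1}"
  have "Max ?A \<in> ?A" using False by (intro Max_in) auto
  have "?A \<subseteq> {..Max ?A}" by (auto intro: Max_ge)
  then have "card ?A \<le> Suc (Max ?A)" using card_mono[of "{..Max ?A}" ?A] by simp
  then have "real (card ?A) * y \<le> real (Suc (Max ?A)) * y"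
    using assms by (intro mult_right_mono) (simp_all only: of_nat_le_iff less_imp_le)
  also have "\<dots> \<le> 1" using \<open>Max ?A \<in> ?A\<close> by blast
  finally show ?thesis .
next
  case True
  then show ?thesis unfolding True by simp
qed

lemma cost_le:
  assumes "2 \<le> T"
  shows "cost T n \<le> 2 * real T ^ n"
proof (induction n)
  case (Suc n)
  have "2 * real T ^ n \<le> real T * real T ^ n" using assms by (intro mult_right_mono) auto
  with Suc show ?case by (simp add: cost_def)
qed (simp add: cost_def)

text \<open>Here \<open>d\<close> stands for 1 - \<alpha>. If \<open>d * T ^ n\<close> exceeds 1/2,
  no type passes level \<open>n\<close> and the induction hypothesis applies. Otherwise the lower
  levels contribute at most 1, even when all types are counted at each of them, and level
  \<open>n\<close> contributes at most 1/2.\<close>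

lemma level_sum_le:
  assumes T: "2 \<le> T" and d: "0 < d"
  shows "d * (\<Sum>k<n. real T ^ k * real (card {t. t < T \<and> d \<le> gap T t k})) \<le> 3 / 2"
proof (induction n)
  case (Suc n)
  let ?N = "\<lambda>k. real (card {t. t < T \<and> d \<le> gap T t k})"
  show ?case
  proof (cases "d * real T ^ n \<le> 1 / 2")
    case True
    have "?N k \<le> real T" for k
      using card_mono[of "{..<T}" "{t. t < T \<and> d \<le> gap T t k}"] by auto
    then have "(\<Sum>k<n. real T ^ k * ?N k) \<le> (\<Sum>k<n. real T ^ k * real T)"
      by (intro sum_mono mult_left_mono) auto
    also have "\<dots> \<le> 2 * real T ^ n" using cost_le[OF T, of n] by (simp add: cost_def mult.commute)
    finally have "d * (\<Sum>k<n. real T ^ k * ?N k) \<le> d * (2 * real T ^ n)"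
      using d by (intro mult_left_mono) auto
    then have 1: "d * (\<Sum>k<n. real T ^ k * ?N k) \<le> 1" using True by simp
    \<comment> \<open>Passing level \<open>n\<close> becomes a condition on multiples of
      \<open>2 * d * T ^ n\<close>, to which the equal-revenue estimate applies.\<close>
    have "d \<le> gap T t n \<longleftrightarrow> real (Suc t) * (2 * d * real T ^ n) \<le> 1" for t
      unfolding gap_def using T
      by (subst pos_le_divide_eq) (simp del: of_nat_Suc, simp add: algebra_simps)
    moreover have "0 < 2 * d * real T ^ n" using T d by simp
    ultimately have "?N n * (2 * d * real T ^ n) \<le> 1"
      using card_multiples_le[of "2 * d * real T ^ n" T] by simp
    with 1 show ?thesis by (simp add: algebra_simps)
  next
    case False
    have "\<not> d \<le> gap T t n" for t
    proof
      assume "d \<le> gap T t n"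
      then have "d * real T ^ n \<le> gap T t n * real T ^ n" by (intro mult_right_mono) auto
      also have "\<dots> = gap T t 0" using T by (simp add: gap_def)
      also have "\<dots> \<le> 1 / 2" using T by (intro gap_bounds) auto
      finally show False using False by simp
    qed
    then show ?thesis using Suc by simp
  qed
qed simp

lemma expected_profit_linear_le:
  assumes T: "2 \<le> T" and M: "0 < M" and \<alpha>: "\<alpha> \<le> 1"
  shows "expected_profit (Suc n) 4 T (cost T) (signal_prob M (cost T) (mean_reward T))
           (signal_reward M) (\<lambda>j. \<alpha> * signal_reward M j) \<le> 3"
    (is "expected_profit _ _ _ ?c ?F ?r ?x \<le> 3")
proof -
  let ?d = "1 - \<alpha>"
  \<comment> \<open>Every increment collected by the chosen action belongs to a level whose
    breakpoint has been passed; each is at most \<open>2 * T ^ Suc k\<close>.\<close>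
  have profit_le: "profit (Suc n) 4 ?c ?F ?r t ?x
      \<le> ?d * (\<Sum>k<n. if ?d \<le> gap T t k then 2 * real T ^ Suc k else 0)" for t
  proof -
    obtain i where i: "i < Suc n"
      and best: "\<And>k. k < Suc n \<Longrightarrow> \<alpha> * mean_reward T t k - ?c k \<le> \<alpha> * mean_reward T t i - ?c i"
      and p: "profit (Suc n) 4 ?c ?F ?r t ?x = ?d * mean_reward T t i"
      using profit_signal_linear[OF zero_less_Suc M] by blast
    have "mean_reward T t i \<le> (\<Sum>k<i. if ?d \<le> gap T t k then 2 * real T ^ Suc k else 0)"
      unfolding mean_reward_def
    proof (rule sum_mono)
      fix k assume "k \<in> {..<i}"
      then have "?d \<le> gap T t k"
        using best_response_breakpoints[of T i n k \<alpha> t] T i best by simp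
      then show "real T ^ Suc k / (1 - gap T t k) \<le> (if ?d \<le> gap T t k then 2 * real T ^ Suc k else 0)"
        using increment_le[of T k t] T by simp
    qed
    also have "\<dots> \<le> (\<Sum>k<n. if ?d \<le> gap T t k then 2 * real T ^ Suc k else 0)"
      using i by (intro sum_mono2) auto
    finally show ?thesis using p \<alpha> by (simp add: mult_left_mono)
  qed
  show ?thesis
  \<comment> \<open>At \<alpha> = 1 the principal keeps nothing, while \<open>level_sum_le\<close>
    requires 1 - \<alpha> to be positive.\<close>
  proof (cases "\<alpha> = 1")
    case True
    then have "(\<Sum>t<T. profit (Suc n) 4 ?c ?F ?r t ?x) \<le> (\<Sum>t<T. 0)"
      using profit_le by (intro sum_mono) simp
    then have "expected_profit (Suc n) 4 T ?c ?F ?r ?x \<le> 0"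
      unfolding expected_profit_def by (simp add: divide_nonpos_nonneg)
    then show ?thesis by simp
  next
    case False
    have "(\<Sum>t<T. profit (Suc n) 4 ?c ?F ?r t ?x)
        \<le> (\<Sum>t<T. ?d * (\<Sum>k<n. if ?d \<le> gap T t k then 2 * real T ^ Suc k else 0))"
      by (intro sum_mono profit_le)
    \<comment> \<open>Summing over types first counts the types that have passed each level; the
      extra factor \<open>T\<close> is later cancelled by the average over types.\<close>
    also have "\<dots> = ?d * (\<Sum>k<n. \<Sum>t<T. if ?d \<le> gap T t k then 2 * real T ^ Suc k else 0)"
      by (subst sum.swap) (simp add: sum_distrib_left)
    also have "(\<Sum>k<n. \<Sum>t<T. if ?d \<le> gap T t k then 2 * real T ^ Suc k else 0)
        = (\<Sum>k<n. 2 * real T * (real T ^ k * real (card {t. t < T \<and> ?d \<le> gap T t k})))"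
    proof (rule sum.cong)
      fix k
      have "(\<Sum>t<T. if ?d \<le> gap T t k then 2 * real T ^ Suc k else 0)
          = (\<Sum>t | t < T \<and> ?d \<le> gap T t k. 2 * real T ^ Suc k)"
        by (subst sum.inter_filter[symmetric]) auto
      then show "(\<Sum>t<T. if ?d \<le> gap T t k then 2 * real T ^ Suc k else 0)
          = 2 * real T * (real T ^ k * real (card {t. t < T \<and> ?d \<le> gap T t k}))"
        by simp
    qed simp
    also have "?d * \<dots> = 2 * real T * (?d * (\<Sum>k<n. real T ^ k * real (card {t. t < T \<and> ?d \<le> gap T t k})))"
      by (simp only: sum_distrib_left[symmetric] mult_ac)
    also have "\<dots> \<le> 2 * real T * (3 / 2)"
      using T \<alpha> False by (intro mult_left_mono level_sum_le) auto
    finally show ?thesis using T by (simp add: expected_profit_def divide_le_eq)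
  qed
qed

section \<open>Lower bound for a single contract and conclusion\<close>

lemma expected_profit_signal_ge:
  assumes T: "0 < T" and M: "0 < M"
  shows "real n * (\<Sum>t<T. 1 / real (Suc t)) / 2
      \<le> expected_profit (Suc n) 4 T (cost T) (signal_prob M (cost T) (mean_reward T))
           (signal_reward M) (\<lambda>j. if j = 2 then M else 0)"
    (is "_ \<le> expected_profit _ _ _ ?c ?F ?r ?x")
proof -
  \<comment> \<open>For every type, the welfare of the top action \<open>n\<close> suffices as a
    lower bound.\<close>
  have "(\<Sum>t<T. real n * real T / (2 * real (Suc t))) \<le> (\<Sum>t<T. profit (Suc n) 4 ?c ?F ?r t ?x)"
    using welfare_ge[OF T, of n] welfare_le_profit_signal[OF M lessI, where c = ?c and R = "mean_reward T"]
    by (intro sum_mono) (blast intro: order.trans)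
  moreover have "(\<Sum>t<T. real n * real T / (2 * real (Suc t)))
      = real T * (real n * (\<Sum>t<T. 1 / real (Suc t)) / 2)"
    by (simp add: sum_distrib_left sum_divide_distrib mult_ac)
  ultimately show ?thesis using T by (simp add: expected_profit_def pos_le_divide_eq mult.commute)
qed

text \<open>The ratio is multiplied out because ln 1 = 0, and positivity of
  \<open>opt_single\<close> excludes trivial instances where both optima vanish. \<open>C\<close> is
  chosen before \<open>n\<close> and \<open>T\<close>, hence absolute.\<close>

theorem corollary10:
  shows "\<exists>C::real. 0 < C \<and>
    (\<forall>n T :: nat. 0 < n \<longrightarrow> 0 < T \<longrightarrow>
      (\<exists>c F r. principal_agent (n + 1) 4 T c F r \<and>
         0 < opt_single (n + 1) 4 T c F r \<and>
         real n * ln (real T) * opt_linear (n + 1) 4 T c F r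
           \<le> C * opt_single (n + 1) 4 T c F r))"
proof (intro exI[of _ 6] conjI allI impI)
  fix n T :: nat
  assume n: "0 < n" and T: "0 < T"
  \<comment> \<open>Expected rewards are at most twice the cost, so expected reward plus cost never
    exceeds this \<open>M\<close>.\<close>
  define M where "M = 3 * cost T n"
  define F where "F = signal_prob M (cost T) (mean_reward T)"
  define r where "r = signal_reward M"
  have cost_mono: "cost T i \<le> cost T n" if "i \<le> n" for i
    unfolding cost_def using that by (intro sum_mono2) auto
  have M: "0 < M" using n T by (auto simp: M_def cost_def intro!: sum_pos)
  have P: "principal_agent (n + 1) 4 T (cost T) F r"
    unfolding F_def r_def
  proof (rule principal_agent_signal)
    fix t i assume "i < n + 1"
    then show "0 \<le> mean_reward T t i \<and> mean_reward T t i + cost T i \<le> M"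
      using mean_reward_bounds[OF T, of t i] cost_mono[of i] by (simp add: M_def)
  qed (use T M in \<open>auto simp: cost_def intro: sum_nonneg\<close>)
  let ?H = "\<Sum>t<T. 1 / real (Suc t)"
  let ?x = "\<lambda>j::nat. if j = 2 then M else 0"
  have "real n * ?H / 2 \<le> expected_profit (n + 1) 4 T (cost T) F r ?x"
    using expected_profit_signal_ge[OF T M] by (simp add: F_def r_def)
  also have "\<dots> \<le> opt_single (n + 1) 4 T (cost T) F r"
    unfolding opt_single_def
    by (rule cSUP_upper[OF _ bdd_above_expected_profit(1)[OF P]]) (use M in \<open>auto simp: contracts_def\<close>)
  finally have single: "real n * ?H / 2 \<le> opt_single (n + 1) 4 T (cost T) F r" .
  have "0 < real n * ?H / 2" using n T by (auto intro!: divide_pos_pos mult_pos_pos sum_pos)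
  with single have pos: "0 < opt_single (n + 1) 4 T (cost T) F r" by linarith
  \<comment> \<open>The constant 6 is 3 * 2: linear contracts earn at most 3, and the single
    contract at least half of \<open>n * ?H\<close>. For \<open>T = 1\<close> the left side is
    0.\<close>
  have "real n * ln (real T) * opt_linear (n + 1) 4 T (cost T) F r
      \<le> 6 * opt_single (n + 1) 4 T (cost T) F r"
  proof (cases "T = 1")
    case False
    then have T2: "2 \<le> T" using T by simp
    have "opt_linear (n + 1) 4 T (cost T) F r \<le> 3"
      unfolding opt_linear_def F_def r_def
      using expected_profit_linear_le[OF T2 M, where n = n] by (intro cSUP_least) auto
    moreover have "0 \<le> real n * ln (real T)" using T by simp
    ultimately have "real n * ln (real T) * opt_linear (n + 1) 4 T (cost T) F r \<le> real n * ln (real T) * 3"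
      by (intro mult_left_mono)
    also have "ln (real T) \<le> ?H"
    proof -
      have "ln (real T) \<le> ln (real (Suc T))" using T by (intro ln_mono) auto
      also have "\<dots> \<le> ?H" by (rule ln_le_harmonic)
      finally show ?thesis .
    qed
    then have "real n * ln (real T) * 3 \<le> real n * ?H * 3"
      by (intro mult_right_mono mult_left_mono) auto
    finally show ?thesis using single by linarith
  qed (use pos in simp)
  with P pos show "\<exists>c F r. principal_agent (n + 1) 4 T c F r \<and>
         0 < opt_single (n + 1) 4 T c F r \<and>
         real n * ln (real T) * opt_linear (n + 1) 4 T c F r
           \<le> 6 * opt_single (n + 1) 4 T c F r"
    by blast
qed simp

end
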